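(* Let $V$ be a 6-dimensional real vector space and let $\omega\in U_+\subset\Lambda^3V^*$. Then there exists a product structure $S\neq\pm I$ on $V$, unique up to sign, such that $$\omega(Sv_1,v_2,v_3)=\omega(v_1,Sv_2,v_3)=\omega(v_1,v_2,Sv_3)\quad\text{for all }v_1,v_2,v_3\in V.$$ (Unique up to sign: if $S$ and $\tilde S$ are two such product structures, then $\tilde S=S$ or $\tilde S=-S$.)
   Context: $V$ is a 6-dimensional real vector space. $U_+\subset\Lambda^3V^*$ is the $GL(V)$-orbit (under pullback $\omega\mapsto\varphi^*\omega$) of the form $\omega_+=\alpha_1\wedge\alpha_2\wedge\alpha_3+\alpha_4\wedge\alpha_5\wedge\alpha_6$, where $\alpha_1,\dots,\alpha_6$ is a basis of $V^*$. A product structure on $V$ is a linear endomorphism $S:V\to V$ with $S^2=I$. *)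

theory Defs
  imports "HOL-Analysis.Analysis"
begin

text \<open>The vector space is the universe of a type \<open>'v::real_vector\<close>; covectors are linear maps
  \<open>'v \<Rightarrow> real\<close> and 3-forms are curried functions of three vectors.\<close>

definition Lambda3 :: "('v::real_vector \<Rightarrow> 'v \<Rightarrow> 'v \<Rightarrow> real) set" where
  "Lambda3 = {\<omega>.
     (\<forall>v w. linear (\<lambda>u. \<omega> u v w)) \<and>
     (\<forall>u w. linear (\<lambda>v. \<omega> u v w)) \<and>
     (\<forall>u v. linear (\<lambda>w. \<omega> u v w)) \<and>
     (\<forall>u v. \<omega> u u v = 0 \<and> \<omega> u v u = 0 \<and> \<omega> v u u = 0)}"

text \<open>Wedge product in the determinant normalisation. With the other usual normalisation (factor
  1/6) the form \<open>omega_plus\<close> below is rescaled, which does not change its orbit.\<close>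

definition wedge3 ::
  "('v::real_vector \<Rightarrow> real) \<Rightarrow> ('v \<Rightarrow> real) \<Rightarrow> ('v \<Rightarrow> real) \<Rightarrow> 'v \<Rightarrow> 'v \<Rightarrow> 'v \<Rightarrow> real" where
  "wedge3 a b c u v w = det (vector [vector [a u, a v, a w],
                                     vector [b u, b v, b w],
                                     vector [c u, c v, c w]] :: real^3^3)"

definition dual_basis6 :: "(nat \<Rightarrow> 'v::real_vector \<Rightarrow> real) \<Rightarrow> bool" where
  "dual_basis6 \<alpha> \<longleftrightarrow>
     (\<forall>i\<in>{1..6}. linear (\<alpha> i)) \<and>
     (\<forall>c :: nat \<Rightarrow> real. (\<forall>v. (\<Sum>i=1..6. c i * \<alpha> i v) = 0) \<longrightarrow> (\<forall>i\<in>{1..6}. c i = 0)) \<and>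
     (\<forall>f :: 'v \<Rightarrow> real. linear f \<longrightarrow> (\<exists>c :: nat \<Rightarrow> real. \<forall>v. f v = (\<Sum>i=1..6. c i * \<alpha> i v)))"

definition omega_plus ::
  "(nat \<Rightarrow> 'v::real_vector \<Rightarrow> real) \<Rightarrow> 'v \<Rightarrow> 'v \<Rightarrow> 'v \<Rightarrow> real" where
  "omega_plus \<alpha> = (\<lambda>u v w. wedge3 (\<alpha> 1) (\<alpha> 2) (\<alpha> 3) u v w + wedge3 (\<alpha> 4) (\<alpha> 5) (\<alpha> 6) u v w)"

definition pullback3 ::
  "('v \<Rightarrow> 'v) \<Rightarrow> ('v::real_vector \<Rightarrow> 'v \<Rightarrow> 'v \<Rightarrow> real) \<Rightarrow> 'v \<Rightarrow> 'v \<Rightarrow> 'v \<Rightarrow> real" where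
  "pullback3 \<phi> \<omega> = (\<lambda>u v w. \<omega> (\<phi> u) (\<phi> v) (\<phi> w))"

definition U_plus ::
  "(nat \<Rightarrow> 'v::real_vector \<Rightarrow> real) \<Rightarrow> ('v \<Rightarrow> 'v \<Rightarrow> 'v \<Rightarrow> real) set" where
  "U_plus \<alpha> = {pullback3 \<phi> (omega_plus \<alpha>) | \<phi>. linear \<phi> \<and> bij \<phi>}"

definition product_structure :: "('v::real_vector \<Rightarrow> 'v) \<Rightarrow> bool" where
  "product_structure S \<longleftrightarrow> linear S \<and> S \<circ> S = id"

definition compatible_product_structure ::
  "('v::real_vector \<Rightarrow> 'v \<Rightarrow> 'v \<Rightarrow> real) \<Rightarrow> ('v \<Rightarrow> 'v) \<Rightarrow> bool" where
  "compatible_product_structure \<omega> S \<longleftrightarrow>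
     product_structure S \<and> S \<noteq> id \<and> S \<noteq> (\<lambda>v. - v) \<and>
     (\<forall>v1 v2 v3. \<omega> (S v1) v2 v3 = \<omega> v1 (S v2) v3 \<and> \<omega> v1 (S v2) v3 = \<omega> v1 v2 (S v3))"

lemma linear_wedge3:
  assumes "linear a" "linear b" "linear c"
  shows "linear (\<lambda>u. wedge3 a b c u v w)" "linear (\<lambda>v. wedge3 a b c u v w)"
    "linear (\<lambda>w. wedge3 a b c u v w)"
  using assms
  by (auto intro!: linearI simp: wedge3_def det_3 linear_add linear_scale algebra_simps)

lemma omega_plus_in_Lambda3:
  assumes "dual_basis6 \<alpha>"
  shows "omega_plus \<alpha> \<in> Lambda3"
proof -
  have "linear (\<alpha> 1)" "linear (\<alpha> 2)" "linear (\<alpha> 3)" "linear (\<alpha> 4)" "linear (\<alpha> 5)" "linear (\<alpha> 6)"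
    using assms by (auto simp: dual_basis6_def)
  then show ?thesis
    by (auto simp: Lambda3_def omega_plus_def intro!: linear_compose_add linear_wedge3)
       (auto simp: wedge3_def det_3 algebra_simps)
qed

lemma U_plus_subset_Lambda3:
  assumes "dual_basis6 \<alpha>"
  shows "U_plus \<alpha> \<subseteq> Lambda3"
proof
  fix \<omega> assume "\<omega> \<in> U_plus \<alpha>"
  then obtain \<phi> where \<phi>: "linear \<phi>" and \<omega>: "\<omega> = pullback3 \<phi> (omega_plus \<alpha>)"
    by (auto simp: U_plus_def)
  show "\<omega> \<in> Lambda3"
    using omega_plus_in_Lambda3[OF assms] linear_compose[OF \<phi>]
    unfolding \<omega> Lambda3_def pullback3_def by (fastforce simp: o_def)
qed

end

theory Submission
  imports Defs
begin

text \<open>Write \<open>\<omega> = \<beta>\<^sub>1\<beta>\<^sub>2\<beta>\<^sub>3 + \<beta>\<^sub>4\<beta>\<^sub>5\<beta>\<^sub>6\<close> in the basis \<open>\<beta>\<close> obtained by pulling \<open>\<alpha>\<close> back, with dual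
  vectors \<open>e\<close>. Comparing \<open>\<omega>(Sv, e\<^sub>2, e\<^sub>3)\<close> with \<open>\<omega>(v, Se\<^sub>2, e\<^sub>3)\<close> and \<open>\<omega>(v, e\<^sub>2, Se\<^sub>3)\<close>, and similarly
  for the other indices, shows that a compatible \<open>S\<close> multiplies \<open>\<beta>\<^sub>1, \<beta>\<^sub>2, \<beta>\<^sub>3\<close> by one scalar and
  \<open>\<beta>\<^sub>4, \<beta>\<^sub>5, \<beta>\<^sub>6\<close> by another. Both scalars are \<open>\<plusminus>1\<close> because \<open>S\<^sup>2 = I\<close>, and they are opposite because
  \<open>S \<noteq> \<plusminus>I\<close>. Conversely the scalars \<open>1\<close> and \<open>-1\<close> define a compatible \<open>S\<close>.\<close>

text \<open>Pulling back a wedge product pulls back its factors, so this reduces every form in the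
  orbit to \<open>omega_plus\<close> of another basis of covectors.\<close>

lemma dual_basis6_compose:
  fixes \<alpha> :: "nat \<Rightarrow> 'v::real_vector \<Rightarrow> real" and \<phi> :: "'v \<Rightarrow> 'v"
  assumes "dual_basis6 \<alpha>" and "linear \<phi>" and "bij \<phi>"
  shows "dual_basis6 (\<lambda>i v. \<alpha> i (\<phi> v))"
  unfolding dual_basis6_def
proof (intro conjI allI impI)
  show "\<forall>i\<in>{1..6}. linear (\<lambda>v. \<alpha> i (\<phi> v))"
    using assms linear_compose[OF \<open>linear \<phi>\<close>] by (auto simp: dual_basis6_def o_def)
next
  fix c :: "nat \<Rightarrow> real"
  assume c: "\<forall>v. (\<Sum>i=1..6. c i * \<alpha> i (\<phi> v)) = 0"
  have "(\<Sum>i=1..6. c i * \<alpha> i v) = 0" for v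
    using c[rule_format, of "inv \<phi> v"] \<open>bij \<phi>\<close> by (simp add: bij_is_surj surj_f_inv_f)
  then show "\<forall>i\<in>{1..6}. c i = 0"
    using assms(1) by (simp add: dual_basis6_def)
next
  \<comment> \<open>To expand \<open>f\<close> in the pulled-back covectors, expand \<open>f\<close>
    after \<open>inv \<phi>\<close> in the \<alpha> covectors and then substitute
    \<open>\<phi> v\<close>.\<close>
  fix f :: "'v \<Rightarrow> real"
  assume f: "linear f"
  have "linear (inv \<phi>)"
  proof (rule linearI)
    show "inv \<phi> (x + y) = inv \<phi> x + inv \<phi> y" for x y
      using assms(2,3) by (intro inv_f_eq) (simp_all add: bij_is_inj bij_is_surj surj_f_inv_f linear_add)
    show "inv \<phi> (r *\<^sub>R x) = r *\<^sub>R inv \<phi> x" for r x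
      using assms(2,3) by (intro inv_f_eq) (simp_all add: bij_is_inj bij_is_surj surj_f_inv_f linear_scale)
  qed
  then have "linear (\<lambda>v. f (inv \<phi> v))"
    using linear_compose[OF _ f, of "inv \<phi>"] by (simp add: o_def)
  then obtain c :: "nat \<Rightarrow> real" where c: "\<forall>v. f (inv \<phi> v) = (\<Sum>i=1..6. c i * \<alpha> i v)"
    using assms(1) unfolding dual_basis6_def by blast
  have "f v = (\<Sum>i=1..6. c i * \<alpha> i (\<phi> v))" for v
    using c[rule_format, of "\<phi> v"] \<open>bij \<phi>\<close> by (simp add: bij_is_inj)
  then show "\<exists>c :: nat \<Rightarrow> real. \<forall>v. f v = (\<Sum>i=1..6. c i * \<alpha> i (\<phi> v))"
    by blast
qed

text \<open>Linear functionals separate points, and each of them is a combination of the six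
  covectors. Identities between vectors, and hence between endomorphisms, can thus be checked in
  coordinates.\<close>

lemma dual_basis6_eqI:
  fixes \<alpha> :: "nat \<Rightarrow> 'v::real_vector \<Rightarrow> real"
  assumes "dual_basis6 \<alpha>" and eq: "\<And>i. i \<in> {1..6} \<Longrightarrow> \<alpha> i v = \<alpha> i w"
  shows "v = w"
proof (rule ccontr)
  assume "v \<noteq> w"
  then have "independent {v - w}"
    by simp
  then obtain f :: "'v \<Rightarrow> real" where f: "linear f" "f (v - w) = 1"
    using linear_independent_extend[of "{v - w}" "\<lambda>_. 1 :: real"] by auto
  then obtain c :: "nat \<Rightarrow> real" where c: "\<forall>x. f x = (\<Sum>i=1..6. c i * \<alpha> i x)"
    using assms(1) unfolding dual_basis6_def by blast
  have "f v = f w"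
    using c eq by simp
  with f show False
    by (simp add: linear_diff)
qed

text \<open>The coordinate map \<open>A\<close> to \<open>real ^ 6\<close> is onto, because a
  nonzero vector orthogonal to its range would be a linear relation among the covectors. The dual
  vectors are preimages of the standard unit vectors.\<close>

lemma dual_basis6_dual_vectors:
  fixes \<alpha> :: "nat \<Rightarrow> 'v::real_vector \<Rightarrow> real"
  assumes "dual_basis6 \<alpha>"
  shows "\<exists>e :: nat \<Rightarrow> 'v. \<forall>i\<in>{1..6}. \<forall>j\<in>{1..6}. \<alpha> i (e j) = of_bool (i = j)"
proof -
  \<comment> \<open>The bijection \<open>g\<close> translates between the index type of
    \<open>real ^ 6\<close> and the numerals 1 to 6.\<close>
  obtain g :: "6 \<Rightarrow> nat" where g: "bij_betw g UNIV {1..6}"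
    using finite_same_card_bij[of "UNIV :: 6 set" "{1..6::nat}"] by auto
  have g_mem: "g k \<in> {1..6}" for k
    using g by (auto simp: bij_betw_def)
  have lin: "linear (\<alpha> i)" if "i \<in> {1..6}" for i
    using assms that by (auto simp: dual_basis6_def)
  define A :: "'v \<Rightarrow> real ^ 6" where "A v = (\<chi> k. \<alpha> (g k) v)" for v
  have "linear A"
    using lin[OF g_mem] by (auto intro!: linearI simp: A_def vec_eq_iff linear_add linear_scale)
  have "surj A"
  proof (rule ccontr)
    assume "\<not> surj A"
    moreover have "span (range A) = range A"
      using linear_subspace_image[OF \<open>linear A\<close> subspace_UNIV] by (simp add: span_eq_iff)
    ultimately have "span (range A) \<noteq> UNIV"
      by (simp del: span_eq_iff)
    from span_not_UNIV_orthogonal[OF this] obtain a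
      where a: "a \<noteq> 0" "\<forall>x\<in>span (range A). a \<bullet> x = 0"
      by blast
    have a_A: "a \<bullet> A v = 0" for v
      using a(2) by (simp add: span_base)
    \<comment> \<open>The entries of \<open>a\<close>, renumbered along \<open>g\<close>, are the
      coefficients of the forbidden relation.\<close>
    define c where "c i = a $ inv_into UNIV g i" for i
    have c_g: "c (g k) = a $ k" for k
      using g by (simp add: c_def bij_betw_def)
    have "(\<Sum>i=1..6. c i * \<alpha> i v) = a \<bullet> A v" for v
      using sum.reindex_bij_betw[OF g, of "\<lambda>i. c i * \<alpha> i v"]
      by (simp add: inner_vec_def A_def c_g)
    then have "\<forall>i\<in>{1..6}. c i = 0"
      using assms a_A unfolding dual_basis6_def by simp
    then have "a = 0"
      using g_mem by (simp add: vec_eq_iff flip: c_g)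
    with a show False
      by simp
  qed
  define e where "e j = inv A (\<chi> k. of_bool (g k = j))" for j
  have "\<alpha> i (e j) = of_bool (i = j)" if "i \<in> {1..6}" for i j
  proof -
    obtain k where k: "g k = i"
      using g \<open>i \<in> {1..6}\<close> by (metis bij_betw_imp_surj_on imageE)
    have "\<alpha> (g k) (e j) = A (e j) $ k"
      by (simp add: A_def)
    also have "\<dots> = of_bool (g k = j)"
      using \<open>surj A\<close> by (simp add: e_def surj_f_inv_f)
    finally show ?thesis
      by (simp add: k)
  qed
  then show ?thesis
    by blast
qed

text \<open>If one argument is \<open>x\<close>, \<open>y\<close> or \<open>z\<close>, the second
  wedge product vanishes, and two such arguments reduce the first to a single coordinate of the
  third. Moving \<open>S\<close> from \<open>v\<close> to either of them gives two expansions of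
  each coordinate of \<open>S v\<close>.\<close>

lemma compatible_scalar_on_block:
  fixes \<omega> :: "'v::real_vector \<Rightarrow> 'v \<Rightarrow> 'v \<Rightarrow> real"
  assumes S12: "\<And>u v w. \<omega> (S u) v w = \<omega> u (S v) w"
    and S23: "\<And>u v w. \<omega> u (S v) w = \<omega> u v (S w)"
    and \<omega>: "\<And>u v w. \<omega> u v w = wedge3 a b c u v w + wedge3 a' b' c' u v w"
    and dual: "a x = 1" "a y = 0" "a z = 0" "b x = 0" "b y = 1" "b z = 0"
      "c x = 0" "c y = 0" "c z = 1"
    and dual': "\<And>v. v \<in> {x, y, z} \<Longrightarrow> a' v = 0 \<and> b' v = 0 \<and> c' v = 0"
  shows "\<exists>l. \<forall>v. a (S v) = l * a v \<and> b (S v) = l * b v \<and> c (S v) = l * c v"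
proof -
  note wedge = \<omega> wedge3_def det_3 dual dual'
  have a1: "a (S v) = a v * b (S y) - b v * a (S y)" for v
    using S12[of v y z] by (simp add: wedge)
  have a2: "a (S v) = a v * c (S z) - c v * a (S z)" for v
    using S12[of v y z] S23[of v y z] by (simp add: wedge)
  have b1: "b (S v) = b v * c (S z) - c v * b (S z)" for v
    using S12[of v z x] by (simp add: wedge)
  have b2: "b (S v) = b v * a (S x) - a v * b (S x)" for v
    using S12[of v z x] S23[of v z x] by (simp add: wedge)
  have c1: "c (S v) = c v * a (S x) - a v * c (S x)" for v
    using S12[of v x y] by (simp add: wedge)
  have c2: "c (S v) = c v * b (S y) - b v * c (S y)" for v
    using S12[of v x y] S23[of v x y] by (simp add: wedge)
  \<comment> \<open>At these vectors both coefficients in the second expansion are zero; the three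
    entries obtained are exactly those occurring in \<open>a1\<close>, \<open>b1\<close> and
    \<open>c1\<close>.\<close>
  have off_diagonal: "a (S y) = 0" "b (S z) = 0" "c (S x) = 0"
    using a2[of y] b2[of z] c2[of x] by (simp_all add: dual)
  have diagonal: "b (S y) = a (S x)" "c (S z) = a (S x)"
    using a1[of x] b1[of y] by (simp_all add: dual)
  have "a (S v) = a (S x) * a v \<and> b (S v) = a (S x) * b v \<and> c (S v) = a (S x) * c v" for v
    using a1[of v] b1[of v] c1[of v] unfolding off_diagonal diagonal by simp
  then show ?thesis
    by blast
qed

lemma omega_plus_compatible_exists:
  fixes \<beta> :: "nat \<Rightarrow> 'v::real_vector \<Rightarrow> real"
  assumes "dual_basis6 \<beta>"
  shows "\<exists>S. compatible_product_structure (omega_plus \<beta>) S"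
proof -
  obtain e :: "nat \<Rightarrow> 'v"
    where e: "\<forall>i\<in>{1..6}. \<forall>j\<in>{1..6}. \<beta> i (e j) = of_bool (i = j)"
    using dual_basis6_dual_vectors[OF assms] by blast
  have lin: "linear (\<beta> i)" if "i \<in> {1..6}" for i
    using assms that by (auto simp: dual_basis6_def)
  \<comment> \<open>These are the eigenvalues of \<open>S\<close> on the vectors \<open>e j\<close>:
    each block of three is an eigenspace.\<close>
  define \<epsilon> :: "nat \<Rightarrow> real" where "\<epsilon> i = (if i \<le> 3 then 1 else -1)" for i
  define S where "S v = (\<Sum>j=1..6. (\<epsilon> j * \<beta> j v) *\<^sub>R e j)" for v
  have \<beta>_S: "\<beta> i (S v) = \<epsilon> i * \<beta> i v" if "i \<in> {1..6}" for i v
  proof -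
    have "\<beta> i (S v) = (\<Sum>j=1..6. \<epsilon> j * \<beta> j v * \<beta> i (e j))"
      using lin[OF that] by (simp add: S_def linear_sum linear_scale)
    also have "\<dots> = (\<Sum>j=1..6. if i = j then \<epsilon> j * \<beta> j v else 0)"
      using that by (intro sum.cong) (auto simp: e)
    finally show ?thesis
      using that by simp
  qed
  have "linear S"
    using lin by (intro linearI dual_basis6_eqI[OF assms])
      (auto simp: \<beta>_S linear_add linear_scale algebra_simps)
  moreover have "S \<circ> S = id"
    by (intro ext dual_basis6_eqI[OF assms]) (auto simp: \<beta>_S \<epsilon>_def)
  \<comment> \<open>The eigenvectors \<open>e 4\<close> and \<open>e 1\<close> have eigenvalues -1
    and 1, which excludes the identity and its negative in turn.\<close>
  moreover have "S \<noteq> id"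
    using \<beta>_S[of 4 "e 4"] by (auto simp: e \<epsilon>_def)
  moreover have "S \<noteq> (\<lambda>v. - v)"
    using \<beta>_S[of 1 "e 1"] linear_neg[OF lin[of 1]] by (auto simp: e \<epsilon>_def)
  \<comment> \<open>Compatibility holds because \<open>S\<close> in any one slot scales the first
    wedge product by 1 and the second by -1.\<close>
  ultimately show ?thesis
    by (auto simp: compatible_product_structure_def product_structure_def omega_plus_def
        wedge3_def det_3 \<beta>_S \<epsilon>_def algebra_simps intro!: exI[of _ S])
qed

text \<open>The only freedom left in \<open>S\<close> is one sign, from which uniqueness follows by
  comparing coordinates.\<close>

lemma omega_plus_compatible_form:
  fixes \<beta> :: "nat \<Rightarrow> 'v::real_vector \<Rightarrow> real"
  assumes "dual_basis6 \<beta>" and S: "compatible_product_structure (omega_plus \<beta>) S"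
  shows "\<exists>\<epsilon> \<in> {1, -1}. \<forall>v. \<forall>i\<in>{1..6}. \<beta> i (S v) = (if i \<le> 3 then \<epsilon> else - \<epsilon>) * \<beta> i v"
proof -
  obtain e :: "nat \<Rightarrow> 'v"
    where e: "\<forall>i\<in>{1..6}. \<forall>j\<in>{1..6}. \<beta> i (e j) = of_bool (i = j)"
    using dual_basis6_dual_vectors[OF assms(1)] by blast
  have lin: "linear (\<beta> i)" if "i \<in> {1..6}" for i
    using assms(1) that by (auto simp: dual_basis6_def)
  have S12: "omega_plus \<beta> (S u) v w = omega_plus \<beta> u (S v) w"
    and S23: "omega_plus \<beta> u (S v) w = omega_plus \<beta> u v (S w)" for u v w
    using S unfolding compatible_product_structure_def by blast+
  have SS: "S (S v) = v" for v
    using S by (auto simp: compatible_product_structure_def product_structure_def fun_eq_iff)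
  have "\<exists>l. \<forall>v. \<beta> 1 (S v) = l * \<beta> 1 v \<and> \<beta> 2 (S v) = l * \<beta> 2 v \<and> \<beta> 3 (S v) = l * \<beta> 3 v"
    by (rule compatible_scalar_on_block[where \<omega> = "omega_plus \<beta>"
          and a' = "\<beta> 4" and b' = "\<beta> 5" and c' = "\<beta> 6"
          and x = "e 1" and y = "e 2" and z = "e 3", OF S12 S23])
      (auto simp: omega_plus_def e)
  then obtain l where l: "\<And>v. \<beta> 1 (S v) = l * \<beta> 1 v"
    "\<And>v. \<beta> 2 (S v) = l * \<beta> 2 v" "\<And>v. \<beta> 3 (S v) = l * \<beta> 3 v"
    by blast
  \<comment> \<open>The same argument applies with the roles of the two blocks exchanged.\<close>
  have "\<exists>l. \<forall>v. \<beta> 4 (S v) = l * \<beta> 4 v \<and> \<beta> 5 (S v) = l * \<beta> 5 v \<and> \<beta> 6 (S v) = l * \<beta> 6 v"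
    by (rule compatible_scalar_on_block[where \<omega> = "omega_plus \<beta>"
          and a' = "\<beta> 1" and b' = "\<beta> 2" and c' = "\<beta> 3"
          and x = "e 4" and y = "e 5" and z = "e 6", OF S12 S23])
      (auto simp: omega_plus_def e)
  then obtain m where m: "\<And>v. \<beta> 4 (S v) = m * \<beta> 4 v"
    "\<And>v. \<beta> 5 (S v) = m * \<beta> 5 v" "\<And>v. \<beta> 6 (S v) = m * \<beta> 6 v"
    by blast
  \<comment> \<open>Apply \<open>S\<close> twice to \<open>e 1\<close> and to \<open>e 4\<close>,
    and read off the first and the fourth coordinate.\<close>
  have "l * l = 1" "m * m = 1"
    using l(1)[of "S (e 1)"] l(1)[of "e 1"] m(1)[of "S (e 4)"] m(1)[of "e 4"]
    by (simp_all add: SS e)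
  then have lm: "l \<in> {1, -1}" "m \<in> {1, -1}"
    by (simp_all add: square_eq_1_iff)
  have "{1..6::nat} = {1, 2, 3, 4, 5, 6}"
    by auto
  then have \<beta>_S: "\<beta> i (S v) = (if i \<le> 3 then l else m) * \<beta> i v" if "i \<in> {1..6}" for i v
    using that by (auto simp: l m simp del: One_nat_def)
  have "\<not> (l = 1 \<and> m = 1)"
  proof
    assume "l = 1 \<and> m = 1"
    then have "S v = v" for v
      by (intro dual_basis6_eqI[OF assms(1)]) (auto simp: \<beta>_S)
    then show False
      using S by (auto simp: compatible_product_structure_def)
  qed
  moreover have "\<not> (l = -1 \<and> m = -1)"
  proof
    assume "l = -1 \<and> m = -1"
    then have "S v = - v" for v
      using lin by (intro dual_basis6_eqI[OF assms(1)])
        (auto simp: \<beta>_S linear_neg)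
    then show False
      using S by (auto simp: compatible_product_structure_def)
  qed
  ultimately have "m = - l"
    using lm by auto
  with lm(1) show ?thesis
    by (intro bexI[of _ l]) (auto simp: \<beta>_S)
qed

lemma omega_plus_compatible_unique:
  fixes \<beta> :: "nat \<Rightarrow> 'v::real_vector \<Rightarrow> real"
  assumes "dual_basis6 \<beta>"
    and "compatible_product_structure (omega_plus \<beta>) S"
    and "compatible_product_structure (omega_plus \<beta>) S'"
  shows "S' = S \<or> S' = (\<lambda>v. - S v)"
proof -
  have lin: "linear (\<beta> i)" if "i \<in> {1..6}" for i
    using assms(1) that by (auto simp: dual_basis6_def)
  obtain s where s: "s \<in> {1, -1}"
    "\<And>v i. i \<in> {1..6} \<Longrightarrow> \<beta> i (S v) = (if i \<le> 3 then s else - s) * \<beta> i v"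
    using omega_plus_compatible_form[OF assms(1,2)] by blast
  obtain s' where s': "s' \<in> {1, -1}"
    "\<And>v i. i \<in> {1..6} \<Longrightarrow> \<beta> i (S' v) = (if i \<le> 3 then s' else - s') * \<beta> i v"
    using omega_plus_compatible_form[OF assms(1,3)] by blast
  consider "s' = s" | "s' = - s"
    using s(1) s'(1) by auto
  then show ?thesis
  proof cases
    case 1
    then have "S' = S"
      by (intro ext dual_basis6_eqI[OF assms(1)]) (simp add: s(2) s'(2))
    then show ?thesis ..
  next
    case 2
    then have "S' = (\<lambda>v. - S v)"
      using lin by (intro ext dual_basis6_eqI[OF assms(1)]) (simp add: s(2) s'(2) linear_neg)
    then show ?thesis ..
  qed
qed

theorem proposition1p4:
  fixes \<alpha> :: "nat \<Rightarrow> 'v::real_vector \<Rightarrow> real"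
    and \<omega> :: "'v \<Rightarrow> 'v \<Rightarrow> 'v \<Rightarrow> real"
  assumes "dim (UNIV :: 'v set) = 6"
    and "dual_basis6 \<alpha>"
    and "\<omega> \<in> U_plus \<alpha>"
  shows "(\<exists>S. compatible_product_structure \<omega> S) \<and>
         (\<forall>S S'. compatible_product_structure \<omega> S \<and> compatible_product_structure \<omega> S' \<longrightarrow>
            S' = S \<or> S' = (\<lambda>v. - S v))"
proof -
  obtain \<phi> where \<phi>: "linear \<phi>" "bij \<phi>" and \<omega>: "\<omega> = pullback3 \<phi> (omega_plus \<alpha>)"
    using assms(3) by (auto simp: U_plus_def)
  have "\<omega> = omega_plus (\<lambda>i v. \<alpha> i (\<phi> v))"
    by (simp add: \<omega> pullback3_def omega_plus_def wedge3_def)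
  then show ?thesis
    using dual_basis6_compose[OF assms(2) \<phi>] omega_plus_compatible_exists
      omega_plus_compatible_unique by blast
qed

end
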